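(* Let $w:[0,\infty)\to\mathbb{R}$ be a weight function such that $w(t)>0$ for all $t>0$, $w$ is non-decreasing, and $w$ is concave. Suppose moreover that $w$ is differentiable with $(w^2)'$ convex, and that $w(0)>0$. Then all Steiner points in minimum Gilbert arborescences with weight function $w$ in Euclidean space (of any dimension) have degree $3$.
   Context: Euclidean space is $\mathbb{R}^k$ with the Euclidean norm $\|\cdot\|_2$. Gilbert arborescences: given a set of terminals consisting of sources $p_1,\dots,p_n$ with positive flow demands $t_1,\dots,t_n$ and a sink $q$, a Gilbert arborescence is a finite tree $T$ whose vertices are (distinct) points of the space and include all the terminals, whose edges are straight segments, and in which the flow $t_i$ from $p_i$ is routed along the unique path of $T$ from $p_i$ to $q$; every edge lies on at least one of these paths. Vertices of $T$ that are not terminals are called Steiner points; they may be arbitrary points of the space, in any finite number. The total flow on an edge $e$ is $t_e=\sum t_i$, summed over all $i$ such that $e$ lies on the path from $p_i$ to $q$. The cost of an edge $e=xy$ is $w(t_e)\|x-y\|_2$, and the cost of $T$ is the sum of the costs of its edges. A minimum Gilbert arborescence is a Gilbert arborescence of minimum cost among all Gilbert arborescences with the same terminals, flow demands and weight function. Convention: the statement concerns Steiner points of degree at least $3$ (trivial Steiner points of degree $2$, such as those subdividing an edge, are disregarded). *)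

theory Defs
  imports "HOL-Analysis.Analysis"
begin

(* Undirected simple graphs with vertex set V and edge set E, an edge being the
   two-element set of its end points.  (The predicate tree of the AFP entry
   Graph_Theory only excludes directed cycles, so it does not describe
   undirected trees.) *)

definition simple_graph :: "'a set \<Rightarrow> 'a set set \<Rightarrow> bool" where
  "simple_graph V E \<longleftrightarrow>
     finite V \<and> (\<forall>e\<in>E. \<exists>x\<in>V. \<exists>y\<in>V. x \<noteq> y \<and> e = {x, y})"

definition graph_path :: "'a set \<Rightarrow> 'a set set \<Rightarrow> 'a \<Rightarrow> 'a list \<Rightarrow> 'a \<Rightarrow> bool" where
  "graph_path V E x xs y \<longleftrightarrow>
     xs \<noteq> [] \<and> hd xs = x \<and> last xs = y \<and> set xs \<subseteq> V \<and> distinct xs \<and>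
     (\<forall>i. Suc i < length xs \<longrightarrow> {xs ! i, xs ! Suc i} \<in> E)"

definition path_edges :: "'a list \<Rightarrow> 'a set set" where
  "path_edges xs = {{xs ! i, xs ! Suc i} | i. Suc i < length xs}"

definition graph_connected :: "'a set \<Rightarrow> 'a set set \<Rightarrow> bool" where
  "graph_connected V E \<longleftrightarrow> (\<forall>x\<in>V. \<forall>y\<in>V. \<exists>xs. graph_path V E x xs y)"

definition graph_cycle :: "'a set \<Rightarrow> 'a set set \<Rightarrow> 'a list \<Rightarrow> bool" where
  "graph_cycle V E xs \<longleftrightarrow>
     length xs \<ge> 3 \<and> graph_path V E (hd xs) xs (last xs) \<and> {last xs, hd xs} \<in> E"

definition is_tree :: "'a set \<Rightarrow> 'a set set \<Rightarrow> bool" where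
  "is_tree V E \<longleftrightarrow>
     simple_graph V E \<and> V \<noteq> {} \<and> graph_connected V E \<and> (\<nexists>xs. graph_cycle V E xs)"

definition degree_of :: "'a set set \<Rightarrow> 'a \<Rightarrow> nat" where
  "degree_of E v = card {e \<in> E. v \<in> e}"

(* In a tree the path from x to y is unique, so the existential quantifier says
   that e lies on the path from x to y. *)
definition lies_on_path :: "'a set \<Rightarrow> 'a set set \<Rightarrow> 'a \<Rightarrow> 'a \<Rightarrow> 'a set \<Rightarrow> bool" where
  "lies_on_path V E x y e \<longleftrightarrow> (\<exists>xs. graph_path V E x xs y \<and> e \<in> path_edges xs)"

(* Throughout, the sources are p 1, ..., p n with demands t 1, ..., t n; values of
   p and t at other indices are irrelevant. *)

definition terminals :: "nat \<Rightarrow> (nat \<Rightarrow> 'a) \<Rightarrow> 'a \<Rightarrow> 'a set" where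
  "terminals n p q = insert q (p ` {1..n})"

definition gilbert_arborescence ::
  "nat \<Rightarrow> (nat \<Rightarrow> 'a::euclidean_space) \<Rightarrow> 'a \<Rightarrow> 'a set \<Rightarrow> 'a set set \<Rightarrow> bool" where
  "gilbert_arborescence n p q V E \<longleftrightarrow>
     is_tree V E \<and> terminals n p q \<subseteq> V \<and>
     (\<forall>e\<in>E. \<exists>i\<in>{1..n}. lies_on_path V E (p i) q e)"

definition edge_flow ::
  "nat \<Rightarrow> (nat \<Rightarrow> 'a) \<Rightarrow> (nat \<Rightarrow> real) \<Rightarrow> 'a \<Rightarrow> 'a set \<Rightarrow> 'a set set \<Rightarrow> 'a set \<Rightarrow> real" where
  "edge_flow n p t q V E e = (\<Sum>i | i \<in> {1..n} \<and> lies_on_path V E (p i) q e. t i)"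

definition edge_length :: "'a::euclidean_space set \<Rightarrow> real" where
  "edge_length e = (THE l. \<exists>x y. e = {x, y} \<and> l = norm (x - y))"

lemma edge_length_doubleton [simp]: "edge_length {x, y} = norm (x - y)"
  unfolding edge_length_def
  by (rule the_equality) (auto simp: doubleton_eq_iff norm_minus_commute)

definition gilbert_cost ::
  "(real \<Rightarrow> real) \<Rightarrow> nat \<Rightarrow> (nat \<Rightarrow> 'a::euclidean_space) \<Rightarrow> (nat \<Rightarrow> real) \<Rightarrow> 'a \<Rightarrow>
     'a set \<Rightarrow> 'a set set \<Rightarrow> real" where
  "gilbert_cost w n p t q V E = (\<Sum>e\<in>E. w (edge_flow n p t q V E e) * edge_length e)"

definition minimum_gilbert_arborescence ::
  "(real \<Rightarrow> real) \<Rightarrow> nat \<Rightarrow> (nat \<Rightarrow> 'a::euclidean_space) \<Rightarrow> (nat \<Rightarrow> real) \<Rightarrow> 'a \<Rightarrow>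
     'a set \<Rightarrow> 'a set set \<Rightarrow> bool" where
  "minimum_gilbert_arborescence w n p t q V E \<longleftrightarrow>
     gilbert_arborescence n p q V E \<and>
     (\<forall>V' E'. gilbert_arborescence n p q V' E' \<longrightarrow>
        gilbert_cost w n p t q V E \<le> gilbert_cost w n p t q V' E')"

definition steiner_points :: "nat \<Rightarrow> (nat \<Rightarrow> 'a) \<Rightarrow> 'a \<Rightarrow> 'a set \<Rightarrow> 'a set" where
  "steiner_points n p q V = V - terminals n p q"

end

theory Submission
  imports Defs
begin

text \<open>
Let \<open>s\<close> be a Steiner point of a minimum arborescence, with in-edges of flows \<open>t\<^sub>1, \<dots>, t\<^sub>m\<close> and
out-edge of flow \<open>t\<^sub>1 + \<dots> + t\<^sub>m\<close>, so that its degree is \<open>m + 1\<close>. Let \<open>x\<^sub>i\<close> be the vector of length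
\<open>w t\<^sub>i\<close> pointing from \<open>s\<close> along the \<open>i\<close>-th in-edge. Minimality gives two conditions on these forces.
The point \<open>s\<close> cannot be moved towards its out-neighbour with profit, which means
\<open>norm (x\<^sub>1 + \<dots> + x\<^sub>m) \<ge> w (t\<^sub>1 + \<dots> + t\<^sub>m)\<close> (\<open>balance_condition\<close>). And two in-edges cannot be merged
with profit shortly before \<open>s\<close>, which means \<open>norm (x\<^sub>i + x\<^sub>j) \<le> w (t\<^sub>i + t\<^sub>j)\<close> (\<open>merge_condition\<close>).

In Euclidean space the norm of \<open>x\<^sub>1 + \<dots> + x\<^sub>m\<close> is determined by the norms of the
\<open>x\<^sub>i\<close> and of their pairwise sums. With \<open>f = w\<^sup>2\<close>, the second condition therefore bounds
\<open>(norm (x\<^sub>1 + \<dots> + x\<^sub>m))\<^sup>2\<close> by the sum of \<open>f (t\<^sub>i + t\<^sub>j)\<close> over all pairs \<open>i < j\<close> minus \<open>(m - 2)\<close> times the sum of \<open>f t\<^sub>i\<close> over all \<open>i\<close>.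
If \<open>f\<close> is a quadratic polynomial, this equals \<open>f (t\<^sub>1 + \<dots> + t\<^sub>m) - f 0 * (m - 1) * (m - 2) / 2\<close>;
if \<open>f'\<close> is convex, the third differences of \<open>f\<close> are nonnegative and it is at most that
(\<open>third_difference_nonneg\<close>, \<open>norm_sum_sq_le\<close>). Together with the first condition and \<open>f 0 > 0\<close> this
forces \<open>(m - 1) * (m - 2) \<le> 0\<close>, so \<open>m \<le> 2\<close>.

Both variations are changes of a tree whose flows must be recomputed. For this purpose an
arborescence is described by the function that maps every vertex to its successor on the path to
the sink; edges then correspond to vertices other than the sink, and the flow on an edge is the
total demand of the sources below it (\<open>parent_tree_of_is_tree\<close>, \<open>gilbert_cost_parent_edges\<close>).
\<close>

section \<open>Third differences and sums of vectors\<close>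

text \<open>
The two inner points have the same sum as the two outer ones, and each is the convex
combination of the outer ones with the weights of the other exchanged.
\<close>
lemma convex_on_four_points:
  fixes g :: "real \<Rightarrow> real"
  assumes g: "convex_on {0..} g" and "a \<ge> 0" "x \<ge> 0" "y \<ge> 0"
  shows "g (x + y) + g (y + a) \<le> g y + g (x + y + a)"
proof (cases "x + a = 0")
  case True
  then have "x = 0" "a = 0" using assms by linarith+
  then show ?thesis by simp
next
  case False
  define u where "u = a / (x + a)"
  have pos: "x + a > 0" using False assms by linarith
  have u: "0 \<le> u" "0 \<le> 1 - u" unfolding u_def using assms pos by (auto simp: field_simps)
  have ua: "u * (x + a) = a" using pos by (simp add: u_def)
  have eq1: "u *\<^sub>R y + (1 - u) *\<^sub>R (x + y + a) = x + y"
    using ua by (simp add: algebra_simps)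
  have eq2: "(1 - u) *\<^sub>R y + u *\<^sub>R (x + y + a) = y + a"
    using ua by (simp add: algebra_simps)
  have "g (x + y) \<le> u * g y + (1 - u) * g (x + y + a)"
    using convex_onD[OF g, of "1 - u" y "x + y + a"] assms u eq1 by simp
  moreover have "g (y + a) \<le> (1 - u) * g y + u * g (x + y + a)"
    using convex_onD[OF g, of u y "x + y + a"] assms u eq2 by simp
  ultimately show ?thesis by (simp add: algebra_simps)
qed

text \<open>
This is how convexity of the derivative enters. As a function of \<open>y\<close>, the difference of the two
sides has as derivative the second difference of \<open>f'\<close> with steps \<open>a\<close> and \<open>x\<close>, which is
nonnegative; at \<open>y = 0\<close> the two sides agree.
\<close>
lemma third_difference_nonneg:
  fixes f f' :: "real \<Rightarrow> real"
  assumes deriv: "\<And>x. x \<ge> 0 \<Longrightarrow> (f has_real_derivative f' x) (at x within {0..})"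
    and convex: "convex_on {0..} f'"
    and nonneg: "a \<ge> 0" "x \<ge> 0" "y \<ge> 0"
  shows "f (x + a) + f (x + y) + f (y + a) + f 0 \<le> f (x + y + a) + f x + f y + f a"
proof -
  define k where "k v = f (x + v + a) - f (x + v) - f (v + a) + f v" for v
  have shift: "((\<lambda>v. f (v + c)) has_real_derivative f' (v + c)) (at v)"
    if "c \<ge> 0" "v > 0" for c v
  proof -
    have "at (v + c) within {0..} = at (v + c)"
      by (rule at_within_interior) (use that in \<open>simp add: interior_real_atLeast\<close>)
    with deriv[of "v + c"] that have "(f has_real_derivative f' (v + c)) (at (v + c))" by simp
    then show ?thesis by (rule DERIV_shift[THEN iffD1])
  qed
  have "continuous_on {0..} f"
    unfolding continuous_on_eq_continuous_within
    using deriv by (metis DERIV_continuous atLeast_iff)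
  then have cont: "continuous_on {0..y} (\<lambda>v. f (v + c))" if "c \<ge> 0" for c
    by (rule continuous_on_compose2) (use that in \<open>auto intro!: continuous_intros\<close>)
  have "k 0 \<le> k y"
  proof (rule DERIV_nonneg_imp_increasing_open[OF nonneg(3)])
    fix v assume v: "0 < v" "v < y"
    have "(k has_real_derivative f' (v + (x + a)) - f' (v + x) - f' (v + a) + f' (v + 0)) (at v)"
      unfolding k_def
      using shift[of "x + a" v] shift[of x v] shift[of a v] shift[of 0 v] v nonneg
      by (auto intro!: derivative_intros simp: add_ac)
    moreover have "0 \<le> f' (v + (x + a)) - f' (v + x) - f' (v + a) + f' (v + 0)"
      using convex_on_four_points[OF convex nonneg(1,2), of v] v by (simp add: add_ac)
    ultimately show "\<exists>D. DERIV k v :> D \<and> 0 \<le> D" by blast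
  next
    show "continuous_on {0..y} k"
      unfolding k_def
      using cont[of "x + a"] cont[of x] cont[of a] cont[of 0] nonneg
      by (auto intro!: continuous_intros simp: add_ac)
  qed
  then show ?thesis by (simp add: k_def)
qed

text \<open>
Read \<open>t i\<close> as a flow and \<open>x i\<close> as a force of size \<open>w (t i)\<close>, with \<open>f = w\<^sup>2\<close>. If no two of the
forces can pull a common edge apart, then all of them together cannot either, and with three
or more forces there is slack, of size a multiple of \<open>f 0\<close>. The forces are added one at a time.
The hypothesis on pairs bounds the inner product of the new force, of flow \<open>a\<close>, with each earlier
one by \<open>h (t i) - f 0\<close>, where \<open>h u = f (u + a) - f u - f a + f 0\<close>. By nonnegative third
differences \<open>h\<close> is superadditive, so the sum of these bounds is at most the corresponding bound
for the total flow; each summand but one contributes an \<open>f 0\<close> to the slack, which makes the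
triangular number in the conclusion.
\<close>
lemma norm_sum_sq_le:
  fixes f f' :: "real \<Rightarrow> real" and x :: "'i \<Rightarrow> 'a::real_inner" and t :: "'i \<Rightarrow> real"
  assumes deriv: "\<And>u. u \<ge> 0 \<Longrightarrow> (f has_real_derivative f' u) (at u within {0..})"
    and convex: "convex_on {0..} f'"
    and "finite S" "S \<noteq> {}"
    and "\<And>i. i \<in> S \<Longrightarrow> t i \<ge> 0"
    and "\<And>i. i \<in> S \<Longrightarrow> (norm (x i))\<^sup>2 = f (t i)"
    and "\<And>i j. i \<in> S \<Longrightarrow> j \<in> S \<Longrightarrow> i \<noteq> j \<Longrightarrow> (norm (x i + x j))\<^sup>2 \<le> f (t i + t j)"
  shows "(norm (sum x S))\<^sup>2
           \<le> f (sum t S) - f 0 * ((real (card S) - 1) * (real (card S) - 2) / 2)"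
  using assms(3-)
proof (induction S rule: finite_ne_induct)
  case (singleton i)
  then show ?case by simp
next
  case (insert j S)
  define a where "a = t j"
  define h where "h u = f (u + a) - f u - f a + f 0" for u
  have a: "a \<ge> 0" and tS: "\<And>i. i \<in> S \<Longrightarrow> t i \<ge> 0"
    using insert.prems(1) by (auto simp: a_def)
  have h_sum: "sum (h \<circ> t) A \<le> h (sum t A)" if "finite A" "A \<subseteq> S" for A
    using that
  proof (induction A rule: finite_induct)
    case empty
    then show ?case by (simp add: h_def)
  next
    case (insert i A)
    then have "sum t A \<ge> 0" "t i \<ge> 0" using tS by (auto intro!: sum_nonneg)
    from third_difference_nonneg[OF deriv convex a this]
    have "h (sum t A) + h (t i) \<le> h (sum t A + t i)" by (simp add: h_def)
    with insert show ?case by (simp add: add.commute)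
  qed
  have inner: "2 * inner (x i) (x j) \<le> h (t i) - f 0" if "i \<in> S" for i
  proof -
    have "(norm (x i + x j))\<^sup>2 \<le> f (t i + a)" "(norm (x i))\<^sup>2 = f (t i)" "(norm (x j))\<^sup>2 = f a"
      using insert.prems that insert.hyps by (auto simp: a_def)
    then show ?thesis
      by (simp add: h_def power2_norm_eq_inner inner_left_distrib inner_right_distrib inner_commute)
  qed
  have "2 * inner (sum x S) (x j) = (\<Sum>i\<in>S. 2 * inner (x i) (x j))"
    by (simp add: inner_sum_left sum_distrib_left)
  also have "\<dots> \<le> (\<Sum>i\<in>S. h (t i) - f 0)"
    by (rule sum_mono) (rule inner)
  also have "\<dots> \<le> h (sum t S) - real (card S) * f 0"
    using h_sum[OF insert.hyps(1)] by (simp add: sum_subtractf o_def)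
  finally have cross: "2 * inner (sum x S) (x j) \<le> h (sum t S) - real (card S) * f 0" .
  have IH: "(norm (sum x S))\<^sup>2
           \<le> f (sum t S) - f 0 * ((real (card S) - 1) * (real (card S) - 2) / 2)"
    using insert.prems by (intro insert.IH) auto
  have "(norm (sum x (insert j S)))\<^sup>2
      = (norm (sum x S))\<^sup>2 + 2 * inner (sum x S) (x j) + (norm (x j))\<^sup>2"
    using insert.hyps
    by (simp add: power2_norm_eq_inner inner_left_distrib inner_right_distrib inner_commute)
  also have "(norm (x j))\<^sup>2 = f a" using insert.prems(2)[of j] by (simp add: a_def)
  finally have "(norm (sum x (insert j S)))\<^sup>2
      \<le> f (sum t S) - f 0 * ((real (card S) - 1) * (real (card S) - 2) / 2)
        + (h (sum t S) - real (card S) * f 0) + f a"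
    using IH cross by linarith
  then show ?case
    using insert.hyps by (simp add: h_def a_def field_simps)
qed

section \<open>First variation of a weighted sum of distances\<close>

text \<open>
Moving \<open>s\<close> in direction \<open>d\<close> shortens the segments to the points \<open>c\<close> at the rates
\<open>inner (sgn (c - s)) d\<close>; the constant \<open>b\<close> is the rate at which the cost of a newly created edge
grows. The new position can be kept away from any finite set, so that it can serve as a new
vertex.
\<close>
lemma first_variation:
  fixes s d :: "'a::euclidean_space"
  assumes C: "finite C" "s \<notin> C"
    and rate: "b < (\<Sum>c\<in>C. k c * inner (sgn (c - s)) d)"
    and V: "finite V" "d \<noteq> 0"
  obtains \<epsilon> where "\<epsilon> > 0" "s + \<epsilon> *\<^sub>R d \<notin> V"
    "(\<Sum>c\<in>C. k c * norm (c - (s + \<epsilon> *\<^sub>R d))) + \<epsilon> * b < (\<Sum>c\<in>C. k c * norm (c - s))"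
proof -
  define g where "g e = (\<Sum>c\<in>C. k c * norm (c - (s + e *\<^sub>R d))) + e * b" for e
  have nd: "((\<lambda>e. norm (c - (s + e *\<^sub>R d))) has_real_derivative - inner (sgn (c - s)) d) (at 0)"
    if "c \<in> C" for c
  proof -
    have ne: "c - s \<noteq> 0" using that C by auto
    have "((\<lambda>e. c - (s + e *\<^sub>R d)) has_derivative (\<lambda>e. - (e *\<^sub>R d))) (at 0)"
      by (auto intro!: derivative_eq_intros)
    moreover have "(norm has_derivative (\<lambda>h. inner h (sgn (c - s)))) (at (c - (s + 0 *\<^sub>R d)))"
      using has_derivative_norm[OF ne] by simp
    ultimately have "((\<lambda>e. norm (c - (s + e *\<^sub>R d))) has_derivative
        (\<lambda>e. inner (- (e *\<^sub>R d)) (sgn (c - s)))) (at 0)"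
      by (rule has_derivative_compose)
    then show ?thesis
      by (rule has_derivative_imp_has_field_derivative) (simp add: inner_commute)
  qed
  have "(g has_real_derivative (\<Sum>c\<in>C. k c * - inner (sgn (c - s)) d) + b) (at 0)"
    unfolding g_def by (auto intro!: derivative_eq_intros nd simp: mult.commute)
  moreover have "(\<Sum>c\<in>C. k c * - inner (sgn (c - s)) d) + b < 0"
    using rate by (simp add: sum_negf)
  ultimately obtain r where r: "r > 0" "\<And>e. 0 < e \<Longrightarrow> e < r \<Longrightarrow> g e < g 0"
    using DERIV_neg_dec_right[of g _ 0] by auto
  have "inj (\<lambda>e. s + e *\<^sub>R d)" using V by (auto simp: inj_on_def)
  then have "finite ((\<lambda>e. s + e *\<^sub>R d) -` V)" using V by (intro finite_vimageI)
  then have "infinite ({0<..<r} - (\<lambda>e. s + e *\<^sub>R d) -` V)"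
    using r by (simp add: infinite_Ioo)
  then obtain e where "e \<in> {0<..<r} - (\<lambda>e. s + e *\<^sub>R d) -` V"
    by (metis finite.emptyI ex_in_conv)
  then show ?thesis using r(2)[of e] by (intro that[of e]) (auto simp: g_def)
qed

section \<open>Trees as parent functions\<close>

text \<open>
A tree rooted at \<open>q\<close> is encoded by the function that sends each other vertex to the next vertex on
its path to \<open>q\<close>. A strictly decreasing rank replaces both connectedness and the absence of cycles,
which makes it easy to verify that a modified parent function is again a tree. The value of \<open>par\<close>
at \<open>q\<close> and outside \<open>V\<close> is arbitrary.
\<close>
definition parent_tree :: "'a set \<Rightarrow> 'a \<Rightarrow> ('a \<Rightarrow> 'a) \<Rightarrow> bool" where
  "parent_tree V q par \<longleftrightarrow>
     finite V \<and> q \<in> V \<and> (\<forall>v\<in>V - {q}. par v \<in> V) \<and>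
     (\<exists>d::'a \<Rightarrow> nat. \<forall>v\<in>V - {q}. d (par v) < d v)"

definition parent_edges :: "'a set \<Rightarrow> 'a \<Rightarrow> ('a \<Rightarrow> 'a) \<Rightarrow> 'a set set" where
  "parent_edges V q par = (\<lambda>v. {v, par v}) ` (V - {q})"

definition parent_rel :: "'a set \<Rightarrow> 'a \<Rightarrow> ('a \<Rightarrow> 'a) \<Rightarrow> ('a \<times> 'a) set" where
  "parent_rel V q par = {(v, par v) | v. v \<in> V - {q}}"

definition children :: "'a set \<Rightarrow> 'a \<Rightarrow> ('a \<Rightarrow> 'a) \<Rightarrow> 'a \<Rightarrow> 'a set" where
  "children V q par s = {c \<in> V - {q}. par c = s}"

text \<open>
The flow on the edge from \<open>v\<close> to its parent: the demands of all sources that have \<open>v\<close> among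
their ancestors (every vertex being its own ancestor).
\<close>
definition vertex_flow ::
  "nat \<Rightarrow> (nat \<Rightarrow> 'a) \<Rightarrow> (nat \<Rightarrow> real) \<Rightarrow> 'a \<Rightarrow> 'a set \<Rightarrow> ('a \<Rightarrow> 'a) \<Rightarrow> 'a \<Rightarrow> real" where
  "vertex_flow n p t q V par v = (\<Sum>i | i \<in> {1..n} \<and> (p i, v) \<in> (parent_rel V q par)\<^sup>*. t i)"

abbreviation adjacency :: "'a set \<Rightarrow> 'a set set \<Rightarrow> ('a \<times> 'a) set" where
  "adjacency V E \<equiv> {(a, b). a \<in> V \<and> b \<in> V \<and> {a, b} \<in> E}"

lemma graph_path_successively:
  "graph_path V E x xs y \<longleftrightarrow>
     xs \<noteq> [] \<and> hd xs = x \<and> last xs = y \<and> set xs \<subseteq> V \<and> distinct xs \<and>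
     successively (\<lambda>a b. {a, b} \<in> E) xs"
  by (simp add: graph_path_def successively_conv_nth)

text \<open>
A walk is shortened to a path whenever it returns to a vertex that it has already visited.
\<close>
lemma graph_path_of_rtrancl:
  assumes "(x, y) \<in> (adjacency V E)\<^sup>*" "x \<in> V"
  obtains xs where "graph_path V E x xs y"
proof -
  have "\<exists>xs. graph_path V E x xs y"
    using assms(1)
  proof (induction rule: rtrancl_induct)
    case base
    then show ?case
      using assms(2) by (intro exI[of _ "[x]"]) (simp add: graph_path_successively)
  next
    case (step y z)
    then obtain xs where xs: "graph_path V E x xs y" by blast
    show ?case
    proof (cases "z \<in> set xs")
      case True
      then obtain ys zs where "xs = ys @ z # zs" by (meson split_list)
      with xs have "graph_path V E x (ys @ [z]) z"
        by (auto simp: graph_path_successively successively_append_iff hd_append split: if_splits)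
      then show ?thesis by blast
    next
      case False
      with xs step.hyps have "graph_path V E x (xs @ [z]) z"
        by (auto simp: graph_path_successively successively_append_iff)
      then show ?thesis by blast
    qed
  qed
  with that show thesis by blast
qed

lemma rtrancl_of_graph_path:
  assumes "graph_path V E x xs y"
  shows "(x, y) \<in> (adjacency V E)\<^sup>*"
  using assms
proof (induction xs arbitrary: x)
  case Nil
  then show ?case by (simp add: graph_path_def)
next
  case (Cons a xs)
  show ?case
  proof (cases xs)
    case Nil
    with Cons.prems show ?thesis by (auto simp: graph_path_successively)
  next
    case (Cons b ys)
    with Cons.prems have "graph_path V E b xs y" "(x, b) \<in> adjacency V E"
      by (auto simp: graph_path_successively)
    with Cons.IH show ?thesis by (meson converse_rtrancl_into_rtrancl)
  qed
qed

lemma parent_treeE: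
  assumes "parent_tree V q par"
  obtains d :: "'a \<Rightarrow> nat" where "finite V" "q \<in> V" "\<And>v. v \<in> V \<Longrightarrow> v \<noteq> q \<Longrightarrow> par v \<in> V"
    "\<And>v. v \<in> V \<Longrightarrow> v \<noteq> q \<Longrightarrow> d (par v) < d v"
  using assms unfolding parent_tree_def by (metis Diff_iff singletonD)

lemma parent_edge_inj:
  assumes "parent_tree V q par"
  shows "inj_on (\<lambda>v. {v, par v}) (V - {q})"
proof -
  obtain d :: "'a \<Rightarrow> nat" where "\<And>v. v \<in> V \<Longrightarrow> v \<noteq> q \<Longrightarrow> d (par v) < d v"
    using assms by (rule parent_treeE) blast
  then show ?thesis
    by (intro inj_onI) (metis Diff_iff doubleton_eq_iff insertI1 less_asym)
qed

lemma parent_rel_single_valued: "single_valued (parent_rel V q par)"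
  by (auto simp: parent_rel_def single_valued_def)

lemma parent_rel_step: "v \<in> V \<Longrightarrow> v \<noteq> q \<Longrightarrow> par v = u \<Longrightarrow> (v, u) \<in> parent_rel V q par"
  by (auto simp: parent_rel_def)

lemma parent_neq:
  assumes "parent_tree V q par" "v \<in> V" "v \<noteq> q"
  shows "par v \<noteq> v"
proof -
  obtain d :: "'a \<Rightarrow> nat" where "\<And>v. v \<in> V \<Longrightarrow> v \<noteq> q \<Longrightarrow> d (par v) < d v"
    using assms(1) by (rule parent_treeE) blast
  from this[OF assms(2,3)] show ?thesis by auto
qed

lemma parent_rel_depth:
  assumes "(x, y) \<in> (parent_rel V q par)\<^sup>*"
    and "\<And>v. v \<in> V \<Longrightarrow> v \<noteq> q \<Longrightarrow> d (par v) < (d v :: nat)"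
  shows "d y \<le> d x"
  using assms(1)
  by (induction rule: rtrancl_induct) (use assms(2) in \<open>force simp: parent_rel_def\<close>)+

lemma parent_rel_subset_adjacency:
  assumes "parent_tree V q par"
  shows "parent_rel V q par \<subseteq> adjacency V (parent_edges V q par)"
  using assms by (auto simp: parent_rel_def parent_tree_def parent_edges_def)

lemma parent_rel_reaches_root:
  assumes T: "parent_tree V q par" and "v \<in> V"
  shows "(v, q) \<in> (parent_rel V q par)\<^sup>*"
proof -
  obtain d :: "'a \<Rightarrow> nat" where d: "\<And>v. v \<in> V \<Longrightarrow> v \<noteq> q \<Longrightarrow> d (par v) < d v"
    and V: "\<And>v. v \<in> V \<Longrightarrow> v \<noteq> q \<Longrightarrow> par v \<in> V"
    using T by (rule parent_treeE) blast
  show ?thesis using \<open>v \<in> V\<close>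
  proof (induction "d v" arbitrary: v rule: less_induct)
    case less
    show ?case
    proof (cases "v = q")
      case False
      then have "(par v, q) \<in> (parent_rel V q par)\<^sup>*" using less d V by blast
      moreover have "(v, par v) \<in> parent_rel V q par" using False less.prems by (auto simp: parent_rel_def)
      ultimately show ?thesis by (meson converse_rtrancl_into_rtrancl)
    qed simp
  qed
qed

lemma adjacency_sym: "sym (adjacency V E)"
  by (auto simp: sym_def insert_commute)

text \<open>
A cycle is impossible because at a vertex of largest rank both of its neighbours on the cycle
would have to be the parent.
\<close>
lemma is_tree_parent_edges:
  assumes T: "parent_tree V q par"
  shows "is_tree V (parent_edges V q par)"
proof -
  let ?E = "parent_edges V q par"
  obtain d :: "'a \<Rightarrow> nat" where fin: "finite V" and q: "q \<in> V"
    and V: "\<And>v. v \<in> V \<Longrightarrow> v \<noteq> q \<Longrightarrow> par v \<in> V"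
    and d: "\<And>v. v \<in> V \<Longrightarrow> v \<noteq> q \<Longrightarrow> d (par v) < d v"
    using T by (rule parent_treeE) blast
  have "simple_graph V ?E"
    unfolding simple_graph_def
  proof (intro conjI fin ballI)
    fix e assume "e \<in> ?E"
    then obtain v where "v \<in> V" "v \<noteq> q" "e = {v, par v}" by (auto simp: parent_edges_def)
    moreover from this have "par v \<in> V" "v \<noteq> par v" using V d[of v] by auto
    ultimately show "\<exists>x\<in>V. \<exists>y\<in>V. x \<noteq> y \<and> e = {x, y}" by blast
  qed
  moreover have "graph_connected V ?E"
    unfolding graph_connected_def
  proof (intro ballI)
    fix x y assume "x \<in> V" "y \<in> V"
    then have "(x, q) \<in> (adjacency V ?E)\<^sup>*" "(y, q) \<in> (adjacency V ?E)\<^sup>*"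
      using parent_rel_reaches_root[OF T] rtrancl_mono[OF parent_rel_subset_adjacency[OF T]] by blast+
    moreover have "(q, y) \<in> (adjacency V ?E)\<^sup>*"
      using calculation(2) by (rule symD[OF sym_rtrancl[OF adjacency_sym]])
    ultimately have "(x, y) \<in> (adjacency V ?E)\<^sup>*" by (meson rtrancl_trans)
    then obtain xs where "graph_path V ?E x xs y"
      using \<open>x \<in> V\<close> by (rule graph_path_of_rtrancl)
    then show "\<exists>xs. graph_path V ?E x xs y" by blast
  qed
  moreover have "\<not> graph_cycle V ?E xs" for xs
  proof
    assume cyc: "graph_cycle V ?E xs"
    let ?l = "length xs"
    have len: "?l \<ge> 3" and dist: "distinct xs"
      and step: "\<And>i. Suc i < ?l \<Longrightarrow> {xs ! i, xs ! Suc i} \<in> ?E"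
      and close: "{xs ! (?l - 1), xs ! 0} \<in> ?E"
      using cyc by (auto simp: graph_cycle_def graph_path_def last_conv_nth hd_conv_nth)
    have "Max (d ` set xs) \<in> d ` set xs" using len by (intro Max_in) auto
    then obtain i where i: "i < ?l" "d (xs ! i) = Max (d ` set xs)"
      by (metis imageE in_set_conv_nth)
    have top: "d (xs ! j) \<le> d (xs ! i)" if "j < ?l" for j
      using that i by simp
    (* An edge leads to the parent from its end of higher rank. *)
    have up: "xs ! j = par (xs ! i)" if "j < ?l" "{xs ! i, xs ! j} \<in> ?E" for j
      using that(2) top[OF that(1)] d unfolding parent_edges_def
      by (auto simp: doubleton_eq_iff) (metis leD)
    (* The two cyclic neighbours of position i. *)
    define j where "j = (if Suc i = ?l then 0 else Suc i)"
    define k where "k = (if i = 0 then ?l - 1 else i - 1)"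
    have "j < ?l" "k < ?l" "j \<noteq> k" using i len by (auto simp: j_def k_def)
    moreover have "{xs ! i, xs ! j} \<in> ?E"
    proof (cases "Suc i = ?l")
      case True
      then have "?l - 1 = i" "j = 0" by (simp_all add: j_def)
      with close show ?thesis by (simp only:)
    next
      case False
      with step[of i] i show ?thesis by (simp add: j_def)
    qed
    moreover have "{xs ! i, xs ! k} \<in> ?E"
      using step[of "i - 1"] close i len by (auto simp: k_def insert_commute)
    ultimately show False
      using up[of j] up[of k] dist by (metis nth_eq_iff_index_eq)
  qed
  ultimately show ?thesis using q by (auto simp: is_tree_def)
qed

text \<open>
The rank is the distance to \<open>q\<close>, and a parent is any neighbour at smaller distance. An edge that is
not of the form \<open>{v, par v}\<close> would close a cycle with a path in the tree formed by the parent
edges.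
\<close>
lemma parent_tree_of_is_tree:
  assumes tree: "is_tree V E" and q: "q \<in> V"
  obtains par where "parent_tree V q par" "E = parent_edges V q par"
proof -
  let ?A = "adjacency V E"
  have simple: "simple_graph V E" using tree by (simp add: is_tree_def)
  define d where "d v = (LEAST k. (v, q) \<in> ?A ^^ k)" for v
  have d: "(v, q) \<in> ?A ^^ d v" if v: "v \<in> V" for v
  proof -
    obtain xs where "graph_path V E v xs q"
      using tree v q unfolding is_tree_def graph_connected_def by blast
    then have "(v, q) \<in> ?A\<^sup>*" by (rule rtrancl_of_graph_path)
    then obtain k where "(v, q) \<in> ?A ^^ k" by (blast dest: rtrancl_imp_relpow)
    then show ?thesis unfolding d_def by (rule LeastI)
  qed
  have "\<exists>y. (v, y) \<in> ?A \<and> d y < d v" if v: "v \<in> V - {q}" for v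
  proof (cases "d v")
    case 0
    with d[of v] v show ?thesis by auto
  next
    case (Suc k)
    with d[of v] v have "(v, q) \<in> ?A ^^ Suc k" by simp
    from relpow_Suc_D2[OF this] obtain y where y: "(v, y) \<in> ?A" "(y, q) \<in> ?A ^^ k" by blast
    from y(2) have "d y \<le> k" unfolding d_def by (rule Least_le)
    with y Suc show ?thesis by auto
  qed
  then have "\<forall>v\<in>V - {q}. \<exists>y. (v, y) \<in> ?A \<and> d y < d v" by blast
  from bchoice[OF this] obtain par where par: "\<forall>v\<in>V - {q}. (v, par v) \<in> ?A \<and> d (par v) < d v"
    by blast
  have T: "parent_tree V q par"
    using par q simple unfolding parent_tree_def simple_graph_def by blast
  have "e \<in> parent_edges V q par" if e: "e \<in> E" for e
  proof (rule ccontr)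
    assume ne: "e \<notin> parent_edges V q par"
    obtain u v where uv: "u \<in> V" "v \<in> V" "u \<noteq> v" "e = {u, v}"
      using simple e unfolding simple_graph_def by blast
    have "parent_edges V q par \<subseteq> E - {e}"
      using par ne by (auto simp: parent_edges_def)
    moreover obtain xs where "graph_path V (parent_edges V q par) u xs v"
      using is_tree_parent_edges[OF T] uv unfolding is_tree_def graph_connected_def by blast
    ultimately have xs: "graph_path V (E - {e}) u xs v"
      unfolding graph_path_def by blast
    have "length xs \<noteq> 0" "length xs \<noteq> 1" "length xs \<noteq> 2"
      using xs uv by (auto simp: graph_path_successively length_Suc_conv numeral_2_eq_2)
    then have "length xs \<ge> 3" by linarith
    moreover have "graph_path V E u xs v" "hd xs = u" "last xs = v"
      using xs unfolding graph_path_def by blast+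
    ultimately have "graph_cycle V E xs"
      using e uv by (auto simp: graph_cycle_def insert_commute)
    with tree show False by (auto simp: is_tree_def)
  qed
  moreover have "parent_edges V q par \<subseteq> E" using par by (auto simp: parent_edges_def)
  ultimately show thesis using that[OF T] by blast
qed

text \<open>
A path that takes a step away from the root can never turn back, since the only way towards the
root retraces that step; so a path that ends in the root ascends all the time.
\<close>
lemma graph_path_to_root_ascends:
  assumes T: "parent_tree V q par"
    and "graph_path V (parent_edges V q par) x xs q"
  shows "successively (\<lambda>a b. a \<noteq> q \<and> b = par a) xs"
  using assms(2)
proof (induction xs arbitrary: x)
  case Nil
  then show ?case by simp
next
  case (Cons a xs)
  show ?case
  proof (cases xs)
    case Nil
    then show ?thesis by simp
  next
    case (Cons b ys)
    with Cons.prems have path: "graph_path V (parent_edges V q par) b xs q"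
      and e: "{a, b} \<in> parent_edges V q par" and a: "a \<notin> set xs" "last xs = q"
      by (auto simp: graph_path_successively)
    have asc: "successively (\<lambda>a b. a \<noteq> q \<and> b = par a) xs" by (rule Cons.IH[OF path])
    have "b = q \<or> a \<noteq> par b"
      using asc a Cons by (cases ys) auto
    with e have "a \<noteq> q \<and> b = par a"
      by (auto simp: parent_edges_def doubleton_eq_iff)
    with asc Cons show ?thesis by simp
  qed
qed

text \<open>
This identifies the edges of a path to the root with the ancestors of its first vertex, so that
flows can be computed from the parent relation alone.
\<close>
lemma ascending_list_edges:
  assumes "successively (\<lambda>a b. a \<noteq> q \<and> b = par a) xs" "xs \<noteq> []" "last xs = q" "set xs \<subseteq> V"
  shows "path_edges xs = (\<lambda>v. {v, par v}) ` {v. v \<noteq> q \<and> (hd xs, v) \<in> (parent_rel V q par)\<^sup>* \<and> v \<in> V}"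
  using assms
proof (induction xs rule: induct_list012)
  case (2 x)
  have "v = q" if "(q, v) \<in> (parent_rel V q par)\<^sup>*" for v
    using that by (cases rule: converse_rtranclE) (auto simp: parent_rel_def)
  with 2 show ?case by (auto simp: path_edges_def)
next
  case (3 x y zs)
  have split: "path_edges (x # y # zs) = insert {x, y} (path_edges (y # zs))"
  proof -
    have "{i. Suc i < length (x # y # zs)} = insert 0 (Suc ` {i. Suc i < length (y # zs)})"
      by (auto simp: image_iff) (metis Suc_less_eq less_Suc_eq_0_disj)
    moreover have "path_edges us = (\<lambda>i. {us ! i, us ! Suc i}) ` {i. Suc i < length us}" for us :: "'a list"
      by (auto simp: path_edges_def)
    ultimately show ?thesis by (simp add: image_image)
  qed
  have x: "x \<noteq> q" "y = par x" "x \<in> V" using 3 by auto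
  have "(x, v) \<in> (parent_rel V q par)\<^sup>* \<longleftrightarrow> v = x \<or> (y, v) \<in> (parent_rel V q par)\<^sup>*" for v
  proof
    assume "(x, v) \<in> (parent_rel V q par)\<^sup>*"
    then show "v = x \<or> (y, v) \<in> (parent_rel V q par)\<^sup>*"
      by (cases rule: converse_rtranclE) (auto simp: parent_rel_def x)
  next
    have "(x, y) \<in> parent_rel V q par" using x by (auto simp: parent_rel_def)
    then show "v = x \<or> (y, v) \<in> (parent_rel V q par)\<^sup>* \<Longrightarrow> (x, v) \<in> (parent_rel V q par)\<^sup>*"
      by (meson converse_rtrancl_into_rtrancl rtrancl.rtrancl_refl)
  qed
  with 3 split x show ?case by auto
qed simp

lemma lies_on_path_parent_edge:
  assumes T: "parent_tree V q par" and x: "x \<in> V" and v: "v \<in> V - {q}"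
  shows "lies_on_path V (parent_edges V q par) x q {v, par v} \<longleftrightarrow> (x, v) \<in> (parent_rel V q par)\<^sup>*"
proof -
  have edges: "path_edges xs = (\<lambda>v. {v, par v}) ` {v. v \<noteq> q \<and> (x, v) \<in> (parent_rel V q par)\<^sup>* \<and> v \<in> V}"
    if "graph_path V (parent_edges V q par) x xs q" for xs
    using ascending_list_edges[OF graph_path_to_root_ascends[OF T that]] that
    by (auto simp: graph_path_def)
  have "{v, par v} \<in> (\<lambda>v. {v, par v}) ` {v. v \<noteq> q \<and> (x, v) \<in> (parent_rel V q par)\<^sup>* \<and> v \<in> V}
      \<longleftrightarrow> (x, v) \<in> (parent_rel V q par)\<^sup>*"
    using v inj_onD[OF parent_edge_inj[OF T]] by blast
  moreover have "\<exists>xs. graph_path V (parent_edges V q par) x xs q"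
    using is_tree_parent_edges[OF T] x T
    unfolding is_tree_def graph_connected_def parent_tree_def by blast
  ultimately show ?thesis
    unfolding lies_on_path_def by (simp add: edges cong: conj_cong)
qed

lemma gilbert_arborescence_parent_edges:
  assumes T: "parent_tree V q par" and trm: "terminals n p q \<subseteq> V"
  shows "gilbert_arborescence n p q V (parent_edges V q par)
    \<longleftrightarrow> (\<forall>v\<in>V - {q}. \<exists>i\<in>{1..n}. (p i, v) \<in> (parent_rel V q par)\<^sup>*)"
proof -
  have "p i \<in> V" if "i \<in> {1..n}" for i using trm that by (auto simp: terminals_def)
  then show ?thesis
    unfolding gilbert_arborescence_def using is_tree_parent_edges[OF T] trm
    by (auto simp: parent_edges_def lies_on_path_parent_edge[OF T, unfolded parent_edges_def])
qed

lemma gilbert_cost_parent_edges: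
  fixes V :: "'a::euclidean_space set"
  assumes T: "parent_tree V q par" and trm: "terminals n p q \<subseteq> V"
  shows "gilbert_cost w n p t q V (parent_edges V q par)
    = (\<Sum>v\<in>V - {q}. w (vertex_flow n p t q V par v) * norm (v - par v))"
proof -
  have pV: "p i \<in> V" if "i \<in> {1..n}" for i using trm that by (auto simp: terminals_def)
  have "edge_flow n p t q V (parent_edges V q par) {v, par v} = vertex_flow n p t q V par v"
    if "v \<in> V - {q}" for v
    unfolding edge_flow_def vertex_flow_def
    using lies_on_path_parent_edge[OF T _ that] pV by (intro sum.cong) auto
  then show ?thesis
    unfolding gilbert_cost_def
    by (auto simp: parent_edges_def sum.reindex[OF parent_edge_inj[OF T]] intro!: sum.cong)
qed

lemma degree_parent_edges:
  assumes T: "parent_tree V q par" and s: "s \<in> V" "s \<noteq> q"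
  shows "degree_of (parent_edges V q par) s = Suc (card (children V q par s))"
proof -
  obtain d :: "'a \<Rightarrow> nat" where fin: "finite V"
    and d: "\<And>v. v \<in> V \<Longrightarrow> v \<noteq> q \<Longrightarrow> d (par v) < d v"
    using T by (rule parent_treeE) blast
  have "{e \<in> parent_edges V q par. s \<in> e} = (\<lambda>v. {v, par v}) ` insert s (children V q par s)"
    using s by (auto simp: parent_edges_def children_def)
  moreover have "inj_on (\<lambda>v. {v, par v}) (insert s (children V q par s))"
    by (rule inj_on_subset[OF parent_edge_inj[OF T]]) (use s in \<open>auto simp: children_def\<close>)
  moreover have "s \<notin> children V q par s" using d[of s] s by (auto simp: children_def)
  moreover have "finite (children V q par s)" using fin by (simp add: children_def)
  ultimately show ?thesis by (simp add: degree_of_def card_image)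
qed

text \<open>
The ancestors of a vertex form a chain, and two siblings are never comparable in it because the
rank of each is larger than that of their common parent.
\<close>
lemma siblings_have_no_common_descendant:
  assumes T: "parent_tree V q par"
    and c: "c \<in> children V q par s" "c' \<in> children V q par s"
    and x: "(x, c) \<in> (parent_rel V q par)\<^sup>*" "(x, c') \<in> (parent_rel V q par)\<^sup>*"
  shows "c = c'"
proof -
  obtain d :: "'a \<Rightarrow> nat" where d: "\<And>v. v \<in> V \<Longrightarrow> v \<noteq> q \<Longrightarrow> d (par v) < d v"
    using T by (rule parent_treeE) blast
  have no: "a = b" if ab: "(a, b) \<in> (parent_rel V q par)\<^sup>*" "a \<in> children V q par s" "b \<in> children V q par s" for a b
    using ab(1)
  proof (cases rule: converse_rtranclE)
    case (step y)
    then have "(s, b) \<in> (parent_rel V q par)\<^sup>*" using ab by (auto simp: parent_rel_def children_def)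
    then have "d b \<le> d s" using parent_rel_depth[of s b V q par d] d by blast
    moreover have "d s < d b" using ab d[of b] by (auto simp: children_def)
    ultimately show ?thesis by simp
  qed
  show ?thesis
    using single_valued_confluent[OF parent_rel_single_valued x] no c by blast
qed

lemma sum_vertex_flow_children:
  assumes T: "parent_tree V q par" and I: "I \<subseteq> children V q par s"
  shows "(\<Sum>i | i \<in> {1..n} \<and> (\<exists>c\<in>I. (p i, c) \<in> (parent_rel V q par)\<^sup>*). t i)
    = (\<Sum>c\<in>I. vertex_flow n p t q V par c)"
proof -
  have "finite I"
    using I T by (auto simp: children_def parent_tree_def intro: finite_subset)
  let ?D = "\<lambda>c. {i. i \<in> {1..n} \<and> (p i, c) \<in> (parent_rel V q par)\<^sup>*}"
  have "?D c \<inter> ?D c' = {}" if "c \<in> I" "c' \<in> I" "c \<noteq> c'" for c c'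
    using siblings_have_no_common_descendant[OF T, of c s c'] I that by blast
  with \<open>finite I\<close> have "sum t (\<Union>c\<in>I. ?D c) = (\<Sum>c\<in>I. sum t (?D c))"
    by (intro sum.UNION_disjoint) auto
  moreover have "{i. i \<in> {1..n} \<and> (\<exists>c\<in>I. (p i, c) \<in> (parent_rel V q par)\<^sup>*)} = (\<Union>c\<in>I. ?D c)"
    by auto
  ultimately show ?thesis by (simp add: vertex_flow_def)
qed

text \<open>
No demand enters at a vertex that is not a source, so everything that flows out comes from exactly
one of the children.
\<close>
lemma vertex_flow_conservation:
  assumes T: "parent_tree V q par" and s: "s \<notin> p ` {1..n}"
  shows "vertex_flow n p t q V par s = (\<Sum>c\<in>children V q par s. vertex_flow n p t q V par c)"
proof -
  have "(p i, s) \<in> (parent_rel V q par)\<^sup>* \<longleftrightarrow> (\<exists>c\<in>children V q par s. (p i, c) \<in> (parent_rel V q par)\<^sup>*)"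
    if "i \<in> {1..n}" for i
  proof
    assume "(p i, s) \<in> (parent_rel V q par)\<^sup>*"
    then show "\<exists>c\<in>children V q par s. (p i, c) \<in> (parent_rel V q par)\<^sup>*"
      by (cases rule: rtranclE) (use s that in \<open>auto simp: parent_rel_def children_def\<close>)
  next
    assume "\<exists>c\<in>children V q par s. (p i, c) \<in> (parent_rel V q par)\<^sup>*"
    then obtain c where "(p i, c) \<in> (parent_rel V q par)\<^sup>*" "(c, s) \<in> parent_rel V q par"
      by (auto simp: parent_rel_def children_def)
    then show "(p i, s) \<in> (parent_rel V q par)\<^sup>*" by (rule rtrancl_into_rtrancl)
  qed
  then have "vertex_flow n p t q V par s
      = (\<Sum>i | i \<in> {1..n} \<and> (\<exists>c\<in>children V q par s. (p i, c) \<in> (parent_rel V q par)\<^sup>*). t i)"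
    unfolding vertex_flow_def by (intro sum.cong) auto
  then show ?thesis
    using sum_vertex_flow_children[OF T subset_refl] by metis
qed

section \<open>Moving and splitting a Steiner point\<close>

definition parent_cost ::
  "(real \<Rightarrow> real) \<Rightarrow> nat \<Rightarrow> (nat \<Rightarrow> 'a::euclidean_space) \<Rightarrow> (nat \<Rightarrow> real) \<Rightarrow> 'a \<Rightarrow>
     'a set \<Rightarrow> ('a \<Rightarrow> 'a) \<Rightarrow> real" where
  "parent_cost w n p t q V par
     = (\<Sum>v\<in>V - {q}. w (vertex_flow n p t q V par v) * norm (v - par v))"

lemma minimum_le_parent_tree:
  assumes min: "minimum_gilbert_arborescence w n p t q V (parent_edges V q par)"
    and T: "parent_tree V q par" and T': "parent_tree V' q par'"
    and V': "terminals n p q \<subseteq> V'"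
    and covered: "\<And>v. v \<in> V' - {q} \<Longrightarrow> \<exists>i\<in>{1..n}. (p i, v) \<in> (parent_rel V' q par')\<^sup>*"
  shows "parent_cost w n p t q V par \<le> parent_cost w n p t q V' par'"
proof -
  have "terminals n p q \<subseteq> V"
    using min by (simp add: minimum_gilbert_arborescence_def gilbert_arborescence_def)
  moreover have "gilbert_arborescence n p q V' (parent_edges V' q par')"
    using gilbert_arborescence_parent_edges[OF T' V'] covered by blast
  then have "gilbert_cost w n p t q V (parent_edges V q par)
      \<le> gilbert_cost w n p t q V' (parent_edges V' q par')"
    using min unfolding minimum_gilbert_arborescence_def by blast
  ultimately show ?thesis
    using gilbert_cost_parent_edges[OF T] gilbert_cost_parent_edges[OF T' V']
    by (simp add: parent_cost_def)
qed

text \<open>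
The parent function after the vertex \<open>s\<close> has been moved to the new position \<open>z\<close>: conjugation with
the renaming of \<open>s\<close> to \<open>z\<close>.
\<close>
definition shift_parent :: "'a \<Rightarrow> 'a \<Rightarrow> ('a \<Rightarrow> 'a) \<Rightarrow> 'a \<Rightarrow> 'a" where
  "shift_parent s z par v = (id(s := z)) (par ((id(z := s)) v))"

lemma shift_parent_tree:
  assumes T: "parent_tree V q par" and s: "s \<in> V" "s \<noteq> q" and z: "z \<notin> V"
  shows "parent_tree (insert z (V - {s})) q (shift_parent s z par)"
proof -
  obtain d :: "'a \<Rightarrow> nat" where fin: "finite V" and q: "q \<in> V"
    and V: "\<And>v. v \<in> V \<Longrightarrow> v \<noteq> q \<Longrightarrow> par v \<in> V"
    and d: "\<And>v. v \<in> V \<Longrightarrow> v \<noteq> q \<Longrightarrow> d (par v) < d v"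
    using T by (rule parent_treeE) blast
  have "shift_parent s z par v \<in> insert z (V - {s})
      \<and> (d \<circ> id(z := s)) (shift_parent s z par v) < (d \<circ> id(z := s)) v"
    if v: "v \<in> insert z (V - {s}) - {q}" for v
  proof -
    define u where "u = (id(z := s)) v"
    have u: "u \<in> V" "u \<noteq> q" using v s by (auto simp: u_def)
    moreover have "par u \<noteq> z" using V[OF u] z by blast
    ultimately show ?thesis using V[OF u] d[OF u] by (auto simp: shift_parent_def u_def)
  qed
  then show ?thesis using fin q s unfolding parent_tree_def by blast
qed

lemma parent_rel_shift_parent:
  assumes T: "parent_tree V q par" and s: "s \<in> V" "s \<noteq> q" and z: "z \<notin> V"
    and x: "x \<in> V" "x \<noteq> s" and v: "v \<in> V"
  shows "(x, (id(s := z)) v) \<in> (parent_rel (insert z (V - {s})) q (shift_parent s z par))\<^sup>*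
    \<longleftrightarrow> (x, v) \<in> (parent_rel V q par)\<^sup>*" (is "(x, ?\<phi> v) \<in> ?R'\<^sup>* \<longleftrightarrow> (x, v) \<in> ?R\<^sup>*")
proof -
  let ?\<psi> = "id(z := s)"
  have q: "q \<in> V" and V: "\<And>v. v \<in> V \<Longrightarrow> v \<noteq> q \<Longrightarrow> par v \<in> V"
    using T by (auto simp: parent_tree_def)
  have inv: "?\<psi> (?\<phi> u) = u" if "u \<in> V" for u using that z by auto
  have step1: "(?\<phi> a, ?\<phi> b) \<in> ?R'" if ab: "(a, b) \<in> ?R" for a b
  proof -
    have a: "a \<in> V" "a \<noteq> q" "b = par a" using ab by (auto simp: parent_rel_def)
    have "?\<phi> a \<in> insert z (V - {s})" "?\<phi> a \<noteq> q" using a q z by auto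
    then show ?thesis
      by (rule parent_rel_step) (simp only: shift_parent_def inv[OF a(1)] a(3))
  qed
  have step2: "(?\<psi> a, ?\<psi> b) \<in> ?R" if ab: "(a, b) \<in> ?R'" for a b
  proof -
    have a: "a \<in> insert z (V - {s})" "a \<noteq> q" and b: "b = ?\<phi> (par (?\<psi> a))"
      using ab by (auto simp: parent_rel_def shift_parent_def)
    have \<psi>a: "?\<psi> a \<in> V" "?\<psi> a \<noteq> q" using a s by auto
    with b have "?\<psi> b = par (?\<psi> a)" using inv V by metis
    with \<psi>a show ?thesis by (intro parent_rel_step) simp_all
  qed
  have fwd: "(?\<phi> a, ?\<phi> b) \<in> ?R'\<^sup>*" if "(a, b) \<in> ?R\<^sup>*" for a b
    using that by induction (blast intro: rtrancl_into_rtrancl step1)+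
  have bwd: "(?\<psi> a, ?\<psi> b) \<in> ?R\<^sup>*" if "(a, b) \<in> ?R'\<^sup>*" for a b
    using that by induction (blast intro: rtrancl_into_rtrancl step2)+
  have "?\<phi> x = x" "?\<psi> x = x" using x z by auto
  then show ?thesis using fwd[of x v] bwd[of x "?\<phi> v"] inv[OF v] by metis
qed

text \<open>
Moving a Steiner point keeps all flows and changes only the lengths of the edges at that
point. Terminals cannot be moved, hence the assumption on \<open>s\<close>.
\<close>
lemma shift_cost_le:
  fixes V :: "'a::euclidean_space set"
  assumes min: "minimum_gilbert_arborescence w n p t q V (parent_edges V q par)"
    and T: "parent_tree V q par"
    and s: "s \<in> V" "s \<notin> terminals n p q" and z: "z \<notin> V"
  shows "(\<Sum>c\<in>children V q par s. w (vertex_flow n p t q V par c) * norm (c - s))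
           + w (vertex_flow n p t q V par s) * norm (s - par s)
      \<le> (\<Sum>c\<in>children V q par s. w (vertex_flow n p t q V par c) * norm (c - z))
           + w (vertex_flow n p t q V par s) * norm (z - par s)"
proof -
  let ?V = "insert z (V - {s})" and ?par = "shift_parent s z par" and ?\<phi> = "id(s := z)"
  let ?C = "children V q par s" and ?fl = "vertex_flow n p t q V par"
  let ?rest = "V - {q} - insert s ?C"
  obtain d :: "'a \<Rightarrow> nat" where fin: "finite V" and q: "q \<in> V"
    and V: "\<And>v. v \<in> V \<Longrightarrow> v \<noteq> q \<Longrightarrow> par v \<in> V"
    and d: "\<And>v. v \<in> V \<Longrightarrow> v \<noteq> q \<Longrightarrow> d (par v) < d v"
    using T by (rule parent_treeE) blast
  have sq: "s \<noteq> q" using s by (auto simp: terminals_def)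
  have arb: "gilbert_arborescence n p q V (parent_edges V q par)"
    using min by (simp add: minimum_gilbert_arborescence_def)
  then have trm: "terminals n p q \<subseteq> V" by (simp add: gilbert_arborescence_def)
  have pi: "p i \<in> V" "p i \<noteq> s" if "i \<in> {1..n}" for i
    using that trm s by (auto simp: terminals_def)
  have T': "parent_tree ?V q ?par" by (rule shift_parent_tree[OF T s(1) sq z])
  have reach: "(p i, ?\<phi> v) \<in> (parent_rel ?V q ?par)\<^sup>* \<longleftrightarrow> (p i, v) \<in> (parent_rel V q par)\<^sup>*"
    if "i \<in> {1..n}" "v \<in> V" for i v
    by (rule parent_rel_shift_parent[OF T s(1) sq z pi[OF that(1)] that(2)])
  have flow: "vertex_flow n p t q ?V ?par (?\<phi> v) = ?fl v" if "v \<in> V" for v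
    unfolding vertex_flow_def using reach[OF _ that] by (intro sum.cong Collect_cong) blast+
  have img: "?V - {q} = ?\<phi> ` (V - {q})" using s sq z q by (auto simp: image_iff)
  have inj: "inj_on ?\<phi> (V - {q})" using z by (auto simp: inj_on_def)
  have "parent_cost w n p t q V par \<le> parent_cost w n p t q ?V ?par"
  proof (rule minimum_le_parent_tree[OF min T T'])
    show "terminals n p q \<subseteq> ?V" using trm s by auto
    fix v assume "v \<in> ?V - {q}"
    then obtain u where u: "u \<in> V - {q}" "v = ?\<phi> u" using img by blast
    then obtain i where "i \<in> {1..n}" "(p i, u) \<in> (parent_rel V q par)\<^sup>*"
      using gilbert_arborescence_parent_edges[OF T trm] arb by blast
    then show "\<exists>i\<in>{1..n}. (p i, v) \<in> (parent_rel ?V q ?par)\<^sup>*" using reach u by blast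
  qed
  also have "parent_cost w n p t q ?V ?par
      = (\<Sum>v\<in>V - {q}. w (?fl v) * norm (?\<phi> v - ?\<phi> (par v)))"
    unfolding parent_cost_def img sum.reindex[OF inj] o_def
  proof (rule sum.cong[OF refl])
    fix v assume v: "v \<in> V - {q}"
    then have "?par (?\<phi> v) = ?\<phi> (par v)" using z by (auto simp: shift_parent_def)
    then show "w (vertex_flow n p t q ?V ?par (?\<phi> v)) * norm (?\<phi> v - ?par (?\<phi> v))
        = w (?fl v) * norm (?\<phi> v - ?\<phi> (par v))"
      using flow v by simp
  qed
  finally have le: "parent_cost w n p t q V par
      \<le> (\<Sum>v\<in>V - {q}. w (?fl v) * norm (?\<phi> v - ?\<phi> (par v)))" .
  have sC: "s \<notin> ?C" using d[of s] s sq by (auto simp: children_def)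
  have ps: "par s \<noteq> s" using d[of s] s sq by auto
  have split: "sum g (V - {q}) = sum g ?rest + (sum g ?C + g s)" for g :: "'a \<Rightarrow> real"
  proof -
    have "insert s ?C \<subseteq> V - {q}" using s sq by (auto simp: children_def)
    then have "sum g (V - {q}) = sum g ?rest + sum g (insert s ?C)"
      using fin by (intro sum.subset_diff) auto
    moreover have "finite ?C" using fin by (simp add: children_def)
    ultimately show ?thesis using sC by (simp add: add.commute)
  qed
  have "(\<Sum>v\<in>?rest. w (?fl v) * norm (?\<phi> v - ?\<phi> (par v)))
      = (\<Sum>v\<in>?rest. w (?fl v) * norm (v - par v))"
    by (rule sum.cong) (auto simp: children_def)
  moreover have "(\<Sum>v\<in>?C. w (?fl v) * norm (?\<phi> v - ?\<phi> (par v)))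
      = (\<Sum>v\<in>?C. w (?fl v) * norm (v - z))"
    using sC by (intro sum.cong) (auto simp: children_def)
  moreover have "(\<Sum>v\<in>?C. w (?fl v) * norm (v - par v)) = (\<Sum>v\<in>?C. w (?fl v) * norm (v - s))"
    by (rule sum.cong) (auto simp: children_def)
  ultimately show ?thesis
    using le ps unfolding parent_cost_def split by simp
qed

text \<open>
The parent function after the children \<open>I\<close> of \<open>s\<close> have been attached to a new vertex \<open>z\<close> that is
itself a child of \<open>s\<close>.
\<close>
definition split_parent :: "'a set \<Rightarrow> 'a \<Rightarrow> 'a \<Rightarrow> ('a \<Rightarrow> 'a) \<Rightarrow> 'a \<Rightarrow> 'a" where
  "split_parent I s z par v = (if v = z then s else if v \<in> I then z else par v)"

lemma split_parent_tree:
  assumes T: "parent_tree V q par" and s: "s \<in> V" and z: "z \<notin> V"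
    and I: "I \<subseteq> children V q par s"
  shows "parent_tree (insert z V) q (split_parent I s z par)"
proof -
  obtain d :: "'a \<Rightarrow> nat" where fin: "finite V" and q: "q \<in> V"
    and V: "\<And>v. v \<in> V \<Longrightarrow> v \<noteq> q \<Longrightarrow> par v \<in> V"
    and d: "\<And>v. v \<in> V \<Longrightarrow> v \<noteq> q \<Longrightarrow> d (par v) < d v"
    using T by (rule parent_treeE) blast
  (* Doubling the rank leaves room for z strictly between s and the children of s. *)
  define d' where "d' v = (if v = z then 2 * d s + 1 else 2 * d v)" for v
  have "split_parent I s z par v \<in> insert z V \<and> d' (split_parent I s z par v) < d' v"
    if v: "v \<in> insert z V - {q}" for v
  proof (cases "v \<in> I")
    case True
    then have "v \<in> V" "v \<noteq> q" "par v = s" using I by (auto simp: children_def)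
    then show ?thesis using d[of v] True z by (auto simp: split_parent_def d'_def)
  next
    case False
    have "par v \<in> V" "d (par v) < d v" if "v \<noteq> z" using that v V d by auto
    then show ?thesis using False s z by (auto simp: split_parent_def d'_def)
  qed
  then show ?thesis using fin q unfolding parent_tree_def by blast
qed

text \<open>
Inserting \<open>z\<close> only lengthens ancestor chains: old vertices keep their old ancestors, and \<open>z\<close> is
inserted in exactly those chains that enter \<open>s\<close> through a child in \<open>I\<close>.
\<close>
lemma parent_rel_split_parent:
  assumes T: "parent_tree V q par" and s: "s \<in> V" and z: "z \<notin> V"
    and I: "I \<subseteq> children V q par s" and x: "x \<in> V"
  shows "v \<in> V \<Longrightarrow> (x, v) \<in> (parent_rel (insert z V) q (split_parent I s z par))\<^sup>*
           \<longleftrightarrow> (x, v) \<in> (parent_rel V q par)\<^sup>*"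
    and "(x, z) \<in> (parent_rel (insert z V) q (split_parent I s z par))\<^sup>*
           \<longleftrightarrow> (\<exists>c\<in>I. (x, c) \<in> (parent_rel V q par)\<^sup>*)"
proof -
  let ?R' = "parent_rel (insert z V) q (split_parent I s z par)" and ?R = "parent_rel V q par"
  have q: "q \<in> V" and V: "\<And>v. v \<in> V \<Longrightarrow> v \<noteq> q \<Longrightarrow> par v \<in> V"
    using T by (auto simp: parent_tree_def)
  have bwd: "if v = z then \<exists>c\<in>I. (x, c) \<in> ?R\<^sup>* else v \<in> V \<and> (x, v) \<in> ?R\<^sup>*"
    if "(x, v) \<in> ?R'\<^sup>*" for v
    using that
  proof (induction rule: rtrancl_induct)
    case base
    then show ?case using x z by auto
  next
    case (step u v)
    then have u: "u \<in> insert z V" "u \<noteq> q" "v = split_parent I s z par u" by (auto simp: parent_rel_def)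
    consider "u = z" | "u \<noteq> z" "u \<in> I" | "u \<noteq> z" "u \<notin> I" by blast
    then show ?case
    proof cases
      case 1
      with step.IH obtain c where c: "c \<in> I" "(x, c) \<in> ?R\<^sup>*" by auto
      then have "(c, s) \<in> ?R" using I by (auto simp: parent_rel_def children_def)
      with c have "(x, s) \<in> ?R\<^sup>*" by (blast intro: rtrancl_into_rtrancl)
      with 1 u s z show ?thesis by (auto simp: split_parent_def)
    next
      case 2
      with step.IH u show ?thesis by (auto simp: split_parent_def)
    next
      case 3
      with step.IH u have "(x, par u) \<in> ?R\<^sup>*" "par u \<in> V"
        using V parent_rel_step[of u V q par "par u"] by (auto intro: rtrancl_into_rtrancl)
      with 3 u z show ?thesis by (auto simp: split_parent_def)
    qed
  qed
  have zs: "(z, s) \<in> ?R'" by (rule parent_rel_step) (use q z in \<open>auto simp: split_parent_def\<close>)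
  have cz: "(c, z) \<in> ?R'" if "c \<in> I" for c
    by (rule parent_rel_step) (use that I z in \<open>auto simp: split_parent_def children_def\<close>)
  have step: "(a, b) \<in> ?R'\<^sup>*" if ab: "(a, b) \<in> ?R" for a b
  proof (cases "a \<in> I")
    case True
    then have "b = s" using ab I by (auto simp: parent_rel_def children_def)
    then show ?thesis using cz[OF True] zs by (meson r_into_rtrancl rtrancl_into_rtrancl)
  next
    case False
    have a: "a \<in> V" "a \<noteq> q" "b = par a" using ab by (auto simp: parent_rel_def)
    have "(a, b) \<in> ?R'" by (rule parent_rel_step) (use a False z in \<open>auto simp: split_parent_def\<close>)
    then show ?thesis by blast
  qed
  have "?R\<^sup>* \<subseteq> ?R'\<^sup>*" using step by (intro rtrancl_subset_rtrancl) auto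
  then have fwd: "(a, b) \<in> ?R'\<^sup>*" if "(a, b) \<in> ?R\<^sup>*" for a b using that by blast
  show "(x, v) \<in> ?R'\<^sup>* \<longleftrightarrow> (x, v) \<in> ?R\<^sup>*" if "v \<in> V"
  proof -
    have "v \<noteq> z" using that z by blast
    then show ?thesis using bwd[of v] fwd[of x v] by auto
  qed
  show "(x, z) \<in> ?R'\<^sup>* \<longleftrightarrow> (\<exists>c\<in>I. (x, c) \<in> ?R\<^sup>*)"
  proof
    assume "\<exists>c\<in>I. (x, c) \<in> ?R\<^sup>*"
    then obtain c where "c \<in> I" "(x, c) \<in> ?R'\<^sup>*" using fwd by blast
    with cz show "(x, z) \<in> ?R'\<^sup>*" by (blast intro: rtrancl_into_rtrancl)
  qed (use bwd[of z] in simp)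
qed

text \<open>
The new edge from \<open>z\<close> to \<open>s\<close> carries the total flow of the children \<open>I\<close>, and all other flows are
unchanged. For empty \<open>I\<close> the new edge would carry no flow, which an arborescence does not permit.
\<close>
lemma split_cost_le:
  fixes V :: "'a::euclidean_space set"
  assumes min: "minimum_gilbert_arborescence w n p t q V (parent_edges V q par)"
    and T: "parent_tree V q par" and s: "s \<in> V" and z: "z \<notin> V"
    and I: "I \<subseteq> children V q par s" "I \<noteq> {}"
  shows "(\<Sum>c\<in>I. w (vertex_flow n p t q V par c) * norm (c - s))
      \<le> (\<Sum>c\<in>I. w (vertex_flow n p t q V par c) * norm (c - z))
           + w (\<Sum>c\<in>I. vertex_flow n p t q V par c) * norm (z - s)"
proof -
  let ?V = "insert z V" and ?par = "split_parent I s z par"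
  let ?fl = "vertex_flow n p t q V par" and ?fl' = "vertex_flow n p t q ?V ?par"
  have fin: "finite V" and q: "q \<in> V" using T by (auto simp: parent_tree_def)
  have arb: "gilbert_arborescence n p q V (parent_edges V q par)"
    using min by (simp add: minimum_gilbert_arborescence_def)
  then have trm: "terminals n p q \<subseteq> V" by (simp add: gilbert_arborescence_def)
  have pi: "p i \<in> V" if "i \<in> {1..n}" for i using that trm by (auto simp: terminals_def)
  note T' = split_parent_tree[OF T s z I(1)]
  note reach = parent_rel_split_parent[OF T s z I(1) pi]
  have covered: "\<exists>i\<in>{1..n}. (p i, v) \<in> (parent_rel V q par)\<^sup>*" if "v \<in> V - {q}" for v
    using gilbert_arborescence_parent_edges[OF T trm] arb that by blast
  have flow: "?fl' v = ?fl v" if "v \<in> V" for v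
    unfolding vertex_flow_def using reach(1)[OF _ that] by (intro sum.cong Collect_cong) blast+
  have "?fl' z = (\<Sum>i | i \<in> {1..n} \<and> (\<exists>c\<in>I. (p i, c) \<in> (parent_rel V q par)\<^sup>*). t i)"
    unfolding vertex_flow_def using reach(2) by (intro sum.cong Collect_cong) blast+
  then have flowz: "?fl' z = (\<Sum>c\<in>I. ?fl c)"
    using sum_vertex_flow_children[OF T I(1)] by metis
  have "parent_cost w n p t q V par \<le> parent_cost w n p t q ?V ?par"
  proof (rule minimum_le_parent_tree[OF min T T'])
    show "terminals n p q \<subseteq> ?V" using trm by auto
    fix v assume v: "v \<in> ?V - {q}"
    obtain c where c: "c \<in> I" using I by blast
    show "\<exists>i\<in>{1..n}. (p i, v) \<in> (parent_rel ?V q ?par)\<^sup>*"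
    proof (cases "v = z")
      case True
      have "c \<in> V - {q}" using c I by (auto simp: children_def)
      then obtain i where i: "i \<in> {1..n}" "(p i, c) \<in> (parent_rel V q par)\<^sup>*" using covered by blast
      then have "(p i, z) \<in> (parent_rel ?V q ?par)\<^sup>*" using reach(2)[OF i(1)] c by blast
      with i True show ?thesis by blast
    next
      case False
      with v have "v \<in> V - {q}" by blast
      then obtain i where i: "i \<in> {1..n}" "(p i, v) \<in> (parent_rel V q par)\<^sup>*" using covered by blast
      then have "(p i, v) \<in> (parent_rel ?V q ?par)\<^sup>*" using reach(1)[OF i(1)] \<open>v \<in> V - {q}\<close> by blast
      with i show ?thesis by blast
    qed
  qed
  also have "parent_cost w n p t q ?V ?par
      = w (?fl' z) * norm (z - ?par z) + (\<Sum>v\<in>V - {q}. w (?fl' v) * norm (v - ?par v))"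
  proof -
    have "?V - {q} = insert z (V - {q})" "z \<notin> V - {q}" using z q by auto
    then show ?thesis using fin by (simp add: parent_cost_def)
  qed
  also have "(\<Sum>v\<in>V - {q}. w (?fl' v) * norm (v - ?par v))
      = (\<Sum>v\<in>V - {q}. w (?fl v) * norm (v - ?par v))"
    using flow by (intro sum.cong) auto
  also have "?par z = s" by (simp add: split_parent_def)
  finally have le: "(\<Sum>v\<in>V - {q}. w (?fl v) * norm (v - par v))
      \<le> w (\<Sum>c\<in>I. ?fl c) * norm (z - s) + (\<Sum>v\<in>V - {q}. w (?fl v) * norm (v - ?par v))"
    by (simp add: parent_cost_def flowz)
  have IV: "I \<subseteq> V - {q}" using I by (auto simp: children_def)
  have split: "sum g (V - {q}) = sum g (V - {q} - I) + sum g I" for g :: "'a \<Rightarrow> real"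
    using fin IV by (intro sum.subset_diff) auto
  have "(\<Sum>v\<in>V - {q} - I. w (?fl v) * norm (v - ?par v))
      = (\<Sum>v\<in>V - {q} - I. w (?fl v) * norm (v - par v))"
    using z by (intro sum.cong) (auto simp: split_parent_def)
  moreover have "(\<Sum>v\<in>I. w (?fl v) * norm (v - ?par v)) = (\<Sum>v\<in>I. w (?fl v) * norm (v - z))"
    using z IV by (intro sum.cong) (auto simp: split_parent_def)
  moreover have "(\<Sum>v\<in>I. w (?fl v) * norm (v - par v)) = (\<Sum>v\<in>I. w (?fl v) * norm (v - s))"
    using I by (intro sum.cong) (auto simp: children_def)
  ultimately show ?thesis
    using le unfolding split by simp
qed

text \<open>
Pulling the edges of the children \<open>I\<close> together in the direction \<open>u\<close> of their resultant force saves
cost at the rate \<open>norm u * norm u\<close>, while the new edge costs \<open>norm u\<close> times its weight; in a minimum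
arborescence the weight must be at least \<open>norm u\<close>.
\<close>
lemma merge_condition:
  fixes V :: "'a::euclidean_space set"
  assumes min: "minimum_gilbert_arborescence w n p t q V (parent_edges V q par)"
    and T: "parent_tree V q par" and s: "s \<in> V"
    and I: "I \<subseteq> children V q par s" "I \<noteq> {}" and nonneg: "w (\<Sum>c\<in>I. vertex_flow n p t q V par c) \<ge> 0"
  shows "norm (\<Sum>c\<in>I. w (vertex_flow n p t q V par c) *\<^sub>R sgn (c - s))
      \<le> w (\<Sum>c\<in>I. vertex_flow n p t q V par c)"
proof (rule ccontr)
  let ?fl = "vertex_flow n p t q V par"
  define u where "u = (\<Sum>c\<in>I. w (?fl c) *\<^sub>R sgn (c - s))"
  assume "\<not> ?thesis"
  then have gt: "w (\<Sum>c\<in>I. ?fl c) < norm u" by (simp add: u_def)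
  then have u: "u \<noteq> 0" using nonneg by auto
  obtain d :: "'a \<Rightarrow> nat" where fin: "finite V"
    and d: "\<And>v. v \<in> V \<Longrightarrow> v \<noteq> q \<Longrightarrow> d (par v) < d v"
    using T by (rule parent_treeE) blast
  have "s \<notin> I" using I d[of s] by (auto simp: children_def)
  moreover have "finite I" using I fin by (auto simp: children_def intro: finite_subset)
  moreover have "w (\<Sum>c\<in>I. ?fl c) * norm u < (\<Sum>c\<in>I. w (?fl c) * inner (sgn (c - s)) u)"
  proof -
    have "w (\<Sum>c\<in>I. ?fl c) * norm u < norm u * norm u"
      using gt u by (intro mult_strict_right_mono) auto
    also have "\<dots> = inner u u" by (simp add: power2_norm_eq_inner flip: power2_eq_square)
    also have "\<dots> = (\<Sum>c\<in>I. w (?fl c) * inner (sgn (c - s)) u)"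
      by (subst (1) u_def) (simp add: inner_sum_left)
    finally show ?thesis .
  qed
  ultimately obtain e where e: "e > 0" "s + e *\<^sub>R u \<notin> V"
    "(\<Sum>c\<in>I. w (?fl c) * norm (c - (s + e *\<^sub>R u))) + e * (w (\<Sum>c\<in>I. ?fl c) * norm u)
      < (\<Sum>c\<in>I. w (?fl c) * norm (c - s))"
    using fin u by (rule_tac first_variation)
  moreover have "norm (s + e *\<^sub>R u - s) = e * norm u" using e by simp
  ultimately show False
    using split_cost_le[OF min T s e(2) I] by (simp add: algebra_simps)
qed

text \<open>
If the force of the edge to the parent exceeded the resultant force of the children, moving the
Steiner point towards its parent would reduce the cost.
\<close>
lemma balance_condition:
  fixes V :: "'a::euclidean_space set"
  assumes min: "minimum_gilbert_arborescence w n p t q V (parent_edges V q par)"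
    and T: "parent_tree V q par" and s: "s \<in> V" "s \<notin> terminals n p q"
  shows "w (vertex_flow n p t q V par s)
    \<le> norm (\<Sum>c\<in>children V q par s. w (vertex_flow n p t q V par c) *\<^sub>R sgn (c - s))"
proof (rule ccontr)
  let ?fl = "vertex_flow n p t q V par" and ?C = "children V q par s"
  define u where "u = (\<Sum>c\<in>?C. w (?fl c) *\<^sub>R sgn (c - s))"
  define v where "v = sgn (par s - s)"
  assume "\<not> ?thesis"
  then have lt: "norm u < w (?fl s)" by (simp add: u_def)
  obtain d :: "'a \<Rightarrow> nat" where fin: "finite V"
    and d: "\<And>v. v \<in> V \<Longrightarrow> v \<noteq> q \<Longrightarrow> d (par v) < d v"
    using T by (rule parent_treeE) blast
  have sq: "s \<noteq> q" using s by (auto simp: terminals_def)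
  have ps: "par s \<noteq> s" and sC: "s \<notin> ?C" using d[of s] s sq by (auto simp: children_def)
  have pC: "par s \<notin> ?C" using d[of s] d[of "par s"] s sq by (auto simp: children_def)
  have finC: "finite ?C" using fin by (simp add: children_def)
  have v: "norm v = 1" using ps by (simp add: v_def norm_sgn)
  (* One weight function for all neighbours of s: the edge between s and its parent is indexed
     by the parent as an end point but carries the flow of s. *)
  define k where "k c = w (?fl (if c = par s then s else c))" for c
  have kC: "(\<Sum>c\<in>?C. k c * g c) = (\<Sum>c\<in>?C. w (?fl c) * g c)" for g :: "'a \<Rightarrow> real"
    using pC by (intro sum.cong) (auto simp: k_def)
  have kp: "k (par s) = w (?fl s)" by (simp add: k_def)
  have "0 < w (?fl s) + inner u v"
    using Cauchy_Schwarz_ineq2[of u v] v lt by simp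
  also have "\<dots> = w (?fl s) * inner v v + (\<Sum>c\<in>?C. w (?fl c) * inner (sgn (c - s)) v)"
    using v by (simp add: u_def inner_sum_left dot_square_norm)
  also have "\<dots> = (\<Sum>c\<in>insert (par s) ?C. k c * inner (sgn (c - s)) v)"
    using pC finC by (simp add: kC kp flip: v_def)
  finally have rate: "0 < (\<Sum>c\<in>insert (par s) ?C. k c * inner (sgn (c - s)) v)" .
  have "v \<noteq> 0" "s \<notin> insert (par s) ?C" "finite (insert (par s) ?C)"
    using v sC ps finC by auto
  with rate fin obtain e where e: "e > 0" "s + e *\<^sub>R v \<notin> V"
    "(\<Sum>c\<in>insert (par s) ?C. k c * norm (c - (s + e *\<^sub>R v))) + e * 0
      < (\<Sum>c\<in>insert (par s) ?C. k c * norm (c - s))"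
    using first_variation[of "insert (par s) ?C" s 0 k v V] by blast
  with shift_cost_le[OF min T s e(2)] pC finC show False
    by (simp add: kC kp norm_minus_commute)
qed

section \<open>Degrees of Steiner points\<close>
theorem theorem5:
  fixes w dw2 :: "real \<Rightarrow> real"
    and n :: nat
    and p :: "nat \<Rightarrow> 'a::euclidean_space"
    and t :: "nat \<Rightarrow> real"
    and q :: 'a
    and V :: "'a set" and E :: "'a set set"
    and s :: 'a
  assumes w_pos: "\<And>x. x > 0 \<Longrightarrow> w x > 0"
    and w_mono: "mono_on {0..} w"
    and w_concave: "concave_on {0..} w"
    and w_diff: "w differentiable_on {0..}"
    and w_sq_deriv:
      "\<And>x. x \<ge> 0 \<Longrightarrow> ((\<lambda>y. (w y)\<^sup>2) has_real_derivative dw2 x) (at x within {0..})"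
    and w_sq_deriv_convex: "convex_on {0..} dw2"
    and w_zero: "w 0 > 0"
    and sources_distinct: "inj_on p {1..n}"
    and sink_not_source: "q \<notin> p ` {1..n}"
    and demands_pos: "\<And>i. i \<in> {1..n} \<Longrightarrow> t i > 0"
    and minimum: "minimum_gilbert_arborescence w n p t q V E"
    and steiner: "s \<in> steiner_points n p q V"
    and nontrivial: "degree_of E s \<ge> 3"
  shows "degree_of E s = 3"
proof -
  have arb: "gilbert_arborescence n p q V E"
    using minimum by (simp add: minimum_gilbert_arborescence_def)
  then have "is_tree V E" "q \<in> V" by (auto simp: gilbert_arborescence_def terminals_def)
  then obtain par where T: "parent_tree V q par" and E: "E = parent_edges V q par"
    by (rule parent_tree_of_is_tree)
  note min = minimum[unfolded E]
  have s: "s \<in> V" "s \<notin> terminals n p q" using steiner by (auto simp: steiner_points_def)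
  then have sq: "s \<noteq> q" and sp: "s \<notin> p ` {1..n}" by (auto simp: terminals_def)
  let ?C = "children V q par s" and ?fl = "vertex_flow n p t q V par"
  let ?x = "\<lambda>c. w (?fl c) *\<^sub>R sgn (c - s)"
  have deg: "degree_of E s = Suc (card ?C)"
    unfolding E by (rule degree_parent_edges[OF T s(1) sq])
  then have C: "finite ?C" "?C \<noteq> {}" using nontrivial by (auto intro: card_ge_0_finite)
  have fl: "?fl v \<ge> 0" for v
    unfolding vertex_flow_def using demands_pos by (intro sum_nonneg) (auto intro: less_imp_le)
  have w: "w x > 0" if "x \<ge> 0" for x using that w_pos w_zero by (cases "x = 0") auto
  (* Only splits by two children are used; larger sets are covered by norm_sum_sq_le. *)
  have merge: "norm (?x a + ?x b) \<le> w (?fl a + ?fl b)" if "a \<in> ?C" "b \<in> ?C" "a \<noteq> b" for a b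
    using merge_condition[OF min T s(1), of "{a, b}"] that fl[of a] fl[of b] w[of "?fl a + ?fl b"]
    by simp
  have "s \<notin> ?C" using parent_neq[OF T s(1) sq] by (simp add: children_def)
  then have unit: "norm (?x c) = w (?fl c)" if "c \<in> ?C" for c
    using that w[OF fl[of c]] by (auto simp: norm_sgn)
  have "(w (?fl s))\<^sup>2 \<le> (norm (sum ?x ?C))\<^sup>2"
    using balance_condition[OF min T s] w[OF fl[of s]] by (intro power_mono) auto
  also have "\<dots> \<le> (w (sum ?fl ?C))\<^sup>2 - (w 0)\<^sup>2 * ((real (card ?C) - 1) * (real (card ?C) - 2) / 2)"
    using w_sq_deriv w_sq_deriv_convex C
  proof (rule norm_sum_sq_le)
    show "(norm (?x a + ?x b))\<^sup>2 \<le> (w (?fl a + ?fl b))\<^sup>2" if "a \<in> ?C" "b \<in> ?C" "a \<noteq> b" for a b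
      using merge[OF that] by (rule power_mono) simp
  qed (use fl unit in auto)
  finally have "(w 0)\<^sup>2 * ((real (card ?C) - 1) * (real (card ?C) - 2) / 2) \<le> 0"
    using vertex_flow_conservation[OF T sp] by simp
  then have "(real (card ?C) - 1) * (real (card ?C) - 2) \<le> 0"
    using w_zero by (simp add: mult_le_0_iff)
  moreover have "card ?C \<ge> 2" using deg nontrivial by simp
  ultimately have "card ?C = 2" by (auto simp: mult_le_0_iff)
  then show ?thesis using deg by simp
qed

end
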